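(* Let $d\geq 3$ be an integer, $\alpha\in\mathbb{R}$, $0<\epsilon<1$ and $C>0$. Then for every $N_0\in\mathbb{N}$ there exist a finite undirected simple graph $G$ with $|V(G)|\geq N_0$, a weight function $w:V(G)\rightarrow\mathbb{R}_{>0}$ and an independent set $A\subseteq V(G)$ such that: (i) every vertex of $G$ has degree at least $2$ and at most $d-1$ (in particular, $G$ is $d$-claw free); (ii) for every independent set $X\subseteq V(G)$ with $|X|\leq C\cdot\log(|V(G)|)$ we have $w^\alpha(X)\leq w^\alpha(N(X,A))$; (iii) every maximum weight independent set $A^*$ of $G$ satisfies $w(A^* )\geq\frac{d-1-\epsilon}{2}\cdot w(A)$.
   Context: A $d$-claw is a star with a center adjacent to $d$ pairwise non-adjacent talons; a graph is $d$-claw free if it has no induced $d$-claw. For $U,W\subseteq V(G)$, $N(U,W):=\{x\in W:\exists u\in U:\{u,x\}\in E(G)\text{ or }u=x\}$. For $U\subseteq V(G)$, $w(U):=\sum_{u\in U}w(u)$ and $w^\alpha(U):=\sum_{u\in U}w(u)^\alpha$. $\log$ denotes the binary logarithm. *)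

theory Defs
  imports Complex_Main
begin

text \<open>A graph is given by its vertex set \<open>V\<close> and its set \<open>E\<close> of edges, which are
  two-element subsets of \<open>V\<close>; hence there are no loops and no parallel edges.\<close>

definition fin_simple_graph :: "'a set \<Rightarrow> 'a set set \<Rightarrow> bool" where
  "fin_simple_graph V E \<longleftrightarrow> finite V \<and> (\<forall>e\<in>E. e \<subseteq> V \<and> card e = 2)"

definition vertex_degree :: "'a set \<Rightarrow> 'a set set \<Rightarrow> 'a \<Rightarrow> nat" where
  "vertex_degree V E v = card {u \<in> V. {v, u} \<in> E}"

definition independent_set :: "'a set \<Rightarrow> 'a set set \<Rightarrow> 'a set \<Rightarrow> bool" where
  "independent_set V E X \<longleftrightarrow> X \<subseteq> V \<and> (\<forall>u\<in>X. \<forall>v\<in>X. {u, v} \<notin> E)"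

definition induced_claw :: "'a set \<Rightarrow> 'a set set \<Rightarrow> nat \<Rightarrow> 'a \<Rightarrow> 'a set \<Rightarrow> bool" where
  "induced_claw V E d c T \<longleftrightarrow>
     c \<in> V \<and> finite T \<and> card T = d \<and> independent_set V E T \<and> c \<notin> T \<and> (\<forall>t\<in>T. {c, t} \<in> E)"

definition claw_free :: "'a set \<Rightarrow> 'a set set \<Rightarrow> nat \<Rightarrow> bool" where
  "claw_free V E d \<longleftrightarrow> \<not> (\<exists>c T. induced_claw V E d c T)"

definition nbhd :: "'a set set \<Rightarrow> 'a set \<Rightarrow> 'a set \<Rightarrow> 'a set" where
  "nbhd E U W = {x \<in> W. \<exists>u\<in>U. {u, x} \<in> E \<or> u = x}"

definition weight :: "('a \<Rightarrow> real) \<Rightarrow> 'a set \<Rightarrow> real" where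
  "weight w U = (\<Sum>u\<in>U. w u)"

definition weight_pow :: "('a \<Rightarrow> real) \<Rightarrow> real \<Rightarrow> 'a set \<Rightarrow> real" where
  "weight_pow w \<alpha> U = (\<Sum>u\<in>U. w u powr \<alpha>)"

definition max_weight_independent_set ::
    "'a set \<Rightarrow> 'a set set \<Rightarrow> ('a \<Rightarrow> real) \<Rightarrow> 'a set \<Rightarrow> bool" where
  "max_weight_independent_set V E w S \<longleftrightarrow>
     independent_set V E S \<and> (\<forall>X. independent_set V E X \<longrightarrow> weight w X \<le> weight w S)"

end

theory Submission
  imports Defs "HOL-Real_Asymp.Real_Asymp"
begin

text \<open>For \<open>\<alpha> > 0\<close>, let \<open>H\<close> be an almost \<open>(d - 1)\<close>-regular graph on \<open>N\<close> vertices with girth of order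
  \<open>log N\<close>, and let \<open>G\<close> be its vertex-edge incidence graph, with \<open>A\<close> the vertices of \<open>H\<close> (weight \<open>1\<close>)
  and \<open>B\<close> the edges of \<open>H\<close> (weight slightly less than \<open>1\<close>). Then \<open>w(B)\<close> is about
  \<open>(d - 1)/2 * w(A)\<close>. An improving set would be a set of \<open>O(log N)\<close> edges of \<open>H\<close> whose number exceeds
  the number of vertices covered by a constant factor \<open>q > 1\<close>; but such a subgraph has balls growing
  like \<open>q^r\<close> for \<open>r\<close> up to half the girth, so it has polynomially many vertices in \<open>N\<close>.
  For \<open>\<alpha> \<le> 0\<close>, an explicit graph works in which \<open>B\<close> can be matched into vertices of \<open>A\<close> of small
  weight.\<close>

subsection \<open>Girth and expansion\<close>

definition inc_degree :: "'a set set \<Rightarrow> 'a \<Rightarrow> nat" where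
  "inc_degree Y v = card {e \<in> Y. v \<in> e}"

text \<open>Cycles are replaced by nonempty edge sets with all degrees even: parities of degrees add up
  under symmetric differences, so closing up two paths needs no choice of a common branch point.\<close>

definition girth_ge :: "nat \<Rightarrow> 'a set set \<Rightarrow> bool" where
  "girth_ge g E \<longleftrightarrow>
     (\<forall>Y. Y \<subseteq> E \<and> finite Y \<and> Y \<noteq> {} \<and> (\<forall>v. even (inc_degree Y v)) \<longrightarrow> g \<le> card Y)"

fun nball :: "'a set set \<Rightarrow> 'a \<Rightarrow> nat \<Rightarrow> 'a set" where
  "nball E u 0 = {u}"
| "nball E u (Suc n) = nball E u n \<union> {y. \<exists>x\<in>nball E u n. {x, y} \<in> E}"

lemma girth_geD:
  assumes "girth_ge g E" "Y \<subseteq> E" "finite Y" "Y \<noteq> {}" "\<And>v. even (inc_degree Y v)"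
  shows "g \<le> card Y"
  using assms unfolding girth_ge_def by blast

lemma girth_ge_subset: "girth_ge g E \<Longrightarrow> E' \<subseteq> E \<Longrightarrow> girth_ge g E'"
  unfolding girth_ge_def by blast

section \<open>Parity of degrees under symmetric difference\<close>

lemma odd_card_sym_diff:
  assumes "finite A" "finite B"
  shows "odd (card (sym_diff A B)) \<longleftrightarrow> odd (card A) \<noteq> odd (card B)"
proof -
  have 1: "card (sym_diff A B) = card (A - B) + card (B - A)"
    using assms by (intro card_Un_disjoint) auto
  have "card A = card (A - B) + card (A \<inter> B)"
    using assms by (subst card_Un_disjoint [symmetric]) (auto intro: arg_cong [where f = card])
  moreover have "card B = card (B - A) + card (A \<inter> B)"
    using assms by (subst card_Un_disjoint [symmetric]) (auto intro: arg_cong [where f = card])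
  ultimately show ?thesis
    using 1 by auto
qed

lemma odd_inc_degree_sym_diff:
  assumes "finite A" "finite B"
  shows "odd (inc_degree (sym_diff A B) v) \<longleftrightarrow> odd (inc_degree A v) \<noteq> odd (inc_degree B v)"
proof -
  have "{e \<in> sym_diff A B. v \<in> e} = sym_diff {e \<in> A. v \<in> e} {e \<in> B. v \<in> e}"
    by auto
  then show ?thesis
    unfolding inc_degree_def using odd_card_sym_diff [of "{e \<in> A. v \<in> e}" "{e \<in> B. v \<in> e}"] assms
    by simp
qed

lemma inc_degree_singleton: "inc_degree {e} v = (if v \<in> e then 1 else 0)"
proof -
  have "{e' \<in> {e}. v \<in> e'} = (if v \<in> e then {e} else {})"
    by auto
  then show ?thesis
    by (simp add: inc_degree_def)
qed

lemma inc_degree_insert: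
  assumes "finite E" "e \<notin> E"
  shows "inc_degree (insert e E) v = inc_degree E v + (if v \<in> e then 1 else 0)"
proof -
  have "{e' \<in> insert e E. v \<in> e'} = (if v \<in> e then insert e {e' \<in> E. v \<in> e'} else {e' \<in> E. v \<in> e'})"
    by auto
  then show ?thesis
    using assms by (simp add: inc_degree_def)
qed

lemma card_sym_diff_le:
  assumes "finite A" "finite B"
  shows "card (sym_diff A B) \<le> card A + card B"
proof -
  have "card (sym_diff A B) \<le> card (A \<union> B)"
    using assms by (intro card_mono) auto
  then show ?thesis
    using card_Un_le [of A B] by linarith
qed

section \<open>Balls, and paths as edge sets with two odd vertices\<close>

lemma nball_mono_radius: "m \<le> n \<Longrightarrow> nball E u m \<subseteq> nball E u n"
  by (induction n) (auto simp: le_Suc_eq)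

lemma nball_mono_edges: "T \<subseteq> E \<Longrightarrow> nball T u n \<subseteq> nball E u n"
proof (induction n)
  case (Suc n)
  then show ?case by auto
qed simp

lemma center_in_nball: "u \<in> nball E u n"
  using nball_mono_radius [of 0 n E u] by simp

text \<open>Balls are defined by growth at the outer boundary; this is growth at the center, which
  the induction in \<open>odd_ends_in_nball\<close> needs when it removes an edge at the
  start.\<close>

lemma nball_step: "{u, x} \<in> E \<Longrightarrow> v \<in> nball E x n \<Longrightarrow> v \<in> nball E u (Suc n)"
proof (induction n arbitrary: v)
  case (Suc n)
  from Suc.prems(2) consider "v \<in> nball E x n" | y where "y \<in> nball E x n" "{y, v} \<in> E"
    by auto
  then show ?case
  proof cases
    case 1
    with Suc show ?thesis by simp
  next
    case 2
    with Suc have "y \<in> nball E u (Suc n)" by blast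
    with 2 show ?thesis by (metis (mono_tags, lifting) UnI2 mem_Collect_eq nball.simps(2))
  qed
qed auto

lemma card_doubleton_neq: "card {x, y} = 2 \<Longrightarrow> x \<noteq> y"
  by auto

text \<open>A path from \<open>u\<close> to \<open>x\<close> is recorded only through the parity of
  its degrees. For \<open>x = u\<close> the condition asks for even degrees everywhere, so the empty
  set serves.\<close>

lemma nball_path:
  assumes "\<forall>e\<in>E. card e = 2"
  shows "x \<in> nball E u n \<Longrightarrow>
    \<exists>P\<subseteq>E. finite P \<and> card P \<le> n \<and> (\<forall>z. odd (inc_degree P z) \<longleftrightarrow> (z = x) \<noteq> (z = u))"
proof (induction n arbitrary: x)
  case 0
  then show ?case
    by (intro exI [of _ "{}"]) (auto simp: inc_degree_def)
next
  case (Suc n)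
  from Suc.prems consider "x \<in> nball E u n" | y where "y \<in> nball E u n" "{y, x} \<in> E"
    by auto
  then show ?case
  proof cases
    case 1
    then show ?thesis using Suc.IH le_SucI by meson
  next
    case 2
    from Suc.IH [OF this(1)] obtain P where P: "P \<subseteq> E" "finite P" "card P \<le> n"
      "\<And>z. odd (inc_degree P z) \<longleftrightarrow> (z = y) \<noteq> (z = u)" by auto
    have "y \<noteq> x" using assms 2(2) by (intro card_doubleton_neq) blast
    \<comment> \<open>Symmetric difference instead of insertion: if the new edge is already in
      \<open>P\<close>, it cancels, and the parities still come out right.\<close>
    let ?P = "sym_diff P {{y, x}}"
    have "card ?P \<le> Suc n" using card_sym_diff_le [of P "{{y, x}}"] P by simp
    moreover have "odd (inc_degree ?P z) \<longleftrightarrow> (z = x) \<noteq> (z = u)" for z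
      using \<open>y \<noteq> x\<close> P by (subst odd_inc_degree_sym_diff) (auto simp: inc_degree_singleton)
    ultimately show ?thesis
      using P 2 by (intro exI [of _ ?P]) auto
  qed
qed

text \<open>Converse of \<open>nball_path\<close>. Edges are removed one at a time, starting at
  \<open>u\<close>; by parity the walk cannot get stuck before it reaches \<open>v\<close>, and it
  uses each edge at most once.\<close>

lemma odd_ends_in_nball:
  assumes "finite Y" "\<forall>e\<in>Y. card e = 2" "u \<noteq> v"
    "\<And>z. odd (inc_degree Y z) \<longleftrightarrow> z = u \<or> z = v"
  shows "v \<in> nball Y u (card Y)"
  using assms
proof (induction "card Y" arbitrary: Y u)
  case 0
  then have "Y = {}" by simp
  with 0 show ?case by (auto simp: inc_degree_def)
next
  case (Suc n)
  have "odd (inc_degree Y u)" using Suc by blast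
  then have "{e \<in> Y. u \<in> e} \<noteq> {}" unfolding inc_degree_def by fastforce
  then obtain e where e: "e \<in> Y" "u \<in> e" by blast
  then have "card e = 2" using Suc by blast
  then obtain x where x: "e = {u, x}" "x \<noteq> u"
    using e(2) by (metis card_2_iff insertE insert_commute singletonD)
  show ?case
  proof (cases "x = v")
    case True
    with e x have "v \<in> nball Y u 1" by simp
    moreover have "1 \<le> card Y" using Suc.hyps(2) by simp
    ultimately show ?thesis using nball_mono_radius [of 1 "card Y" Y u] by blast
  next
    case False
    let ?Y = "Y - {e}"
    have fin: "finite ?Y" and cn: "n = card ?Y" using Suc.hyps(2) Suc.prems(1) e(1) by simp_all
    \<comment> \<open>Removing \<open>e\<close> flips the parity at \<open>u\<close> and
      \<open>x\<close> only, so the odd vertices are now \<open>x\<close> and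
      \<open>v\<close>.\<close>
    have "inc_degree Y z = inc_degree ?Y z + (if z \<in> e then 1 else 0)" for z
      using inc_degree_insert [of ?Y e z] fin e by (simp add: insert_absorb)
    then have "odd (inc_degree ?Y z) \<longleftrightarrow> z = x \<or> z = v" for z
      using Suc.prems(4) [of z] x \<open>u \<noteq> v\<close> False by (auto split: if_splits)
    then have "v \<in> nball ?Y x (card ?Y)"
      using Suc.prems(2) by (intro Suc.hyps(1) [OF cn fin _ False]) simp_all
    then have "v \<in> nball Y x n"
      using cn nball_mono_edges [of ?Y Y x] by auto
    then show ?thesis
      using nball_step [of u x Y v n] e x Suc.hyps(2) by simp
  qed
qed

lemma finite_neighbours:
  assumes "finite E"
  shows "finite {y. {x, y} \<in> E}" and "card {y. {x, y} \<in> E} \<le> inc_degree E x"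
proof -
  have inj: "inj_on (\<lambda>y. {x, y}) {y. {x, y} \<in> E}"
    by (auto simp: inj_on_def doubleton_eq_iff)
  have sub: "(\<lambda>y. {x, y}) ` {y. {x, y} \<in> E} \<subseteq> {e \<in> E. x \<in> e}"
    by auto
  have fin: "finite {e \<in> E. x \<in> e}" using assms by simp
  show "finite {y. {x, y} \<in> E}"
    using inj sub fin by (rule inj_on_finite)
  show "card {y. {x, y} \<in> E} \<le> inc_degree E x"
    unfolding inc_degree_def using inj sub fin by (rule card_inj_on_le)
qed

lemma finite_nball: "finite E \<Longrightarrow> finite (nball E u n)"
proof (induction n)
  case (Suc n)
  have "{y. \<exists>x\<in>nball E u n. {x, y} \<in> E} = (\<Union>x\<in>nball E u n. {y. {x, y} \<in> E})" by auto
  then show ?case using Suc finite_neighbours(1) [OF Suc.prems] by simp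
qed simp

lemma card_nball_le:
  assumes "finite E" "\<And>x. inc_degree E x \<le> k"
  shows "card (nball E u n) \<le> Suc k ^ n"
proof (induction n)
  case (Suc n)
  let ?S = "nball E u n"
  have *: "{y. \<exists>x\<in>?S. {x, y} \<in> E} = (\<Union>x\<in>?S. {y. {x, y} \<in> E})" by auto
  have "card (\<Union>x\<in>?S. {y. {x, y} \<in> E}) \<le> (\<Sum>x\<in>?S. card {y. {x, y} \<in> E})"
    using finite_nball [OF assms(1)] by (intro card_UN_le)
  also have "\<dots> \<le> (\<Sum>x\<in>?S. k)"
    using finite_neighbours(2) [OF assms(1)] assms(2) by (intro sum_mono) (meson le_trans)
  also have "\<dots> = card ?S * k" by simp
  finally have "card (nball E u (Suc n)) \<le> card ?S + card ?S * k"
    using card_Un_le [of ?S "{y. \<exists>x\<in>?S. {x, y} \<in> E}"] * by simp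
  also have "\<dots> = card ?S * Suc k" by simp
  also have "\<dots> \<le> Suc k ^ n * Suc k" using Suc by (rule mult_le_mono1)
  finally show ?case by (simp add: mult.commute)
qed simp

text \<open>Breadth-first tree: each vertex of a new layer contributes one edge to a parent in the
  previous ball, so distances to \<open>u\<close> are kept.\<close>

lemma nball_spanning_tree:
  assumes "finite E"
  shows "\<exists>T\<subseteq>E. card T \<le> card (nball E u n) \<and> nball E u n \<subseteq> nball T u n"
proof (induction n)
  case 0
  then show ?case by (intro exI [of _ "{}"]) auto
next
  case (Suc n)
  then obtain T where T: "T \<subseteq> E" "card T \<le> card (nball E u n)" "nball E u n \<subseteq> nball T u n" by blast
  let ?S = "nball E u n" and ?R = "nball E u (Suc n) - nball E u n"
  have "\<forall>y\<in>?R. \<exists>x. x \<in> ?S \<and> {x, y} \<in> E" by auto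
  then obtain p where p: "\<And>y. y \<in> ?R \<Longrightarrow> p y \<in> ?S \<and> {p y, y} \<in> E" by metis
  let ?T = "T \<union> (\<lambda>y. {p y, y}) ` ?R"
  have fin: "finite ?R" "finite ?S" using finite_nball [OF assms] by blast+
  have "card ?T \<le> card T + card ?R"
    using card_Un_le [of T] card_image_le [OF fin(1), of "\<lambda>y. {p y, y}"] by (meson add_left_mono le_trans)
  also have "\<dots> \<le> card ?S + card ?R" using T by simp
  also have "\<dots> = card (?S \<union> ?R)" using fin by (intro card_Un_disjoint [symmetric]) auto
  also have "?S \<union> ?R = nball E u (Suc n)" by auto
  finally have "card ?T \<le> card (nball E u (Suc n))" .
  moreover have sub: "?S \<subseteq> nball ?T u n" using T(3) nball_mono_edges [of T ?T u n] by blast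
  moreover have "y \<in> nball ?T u (Suc n)" if "y \<in> nball E u (Suc n)" for y
  proof (cases "y \<in> ?S")
    case False
    then have y: "y \<in> ?R" using that by blast
    then have "{p y, y} \<in> ?T" by blast
    moreover have "p y \<in> nball ?T u n" using p y sub by blast
    ultimately show ?thesis by (subst nball.simps) blast
  qed (use sub in auto)
  moreover have "?T \<subseteq> E" using T p by blast
  ultimately show ?case by (intro exI [of _ ?T]) blast
qed

text \<open>Every edge inside the ball belongs to the breadth-first tree: any other edge, together
  with the tree paths from \<open>u\<close> to its ends, would give a nonempty even edge set of size
  at most 2n + 1.\<close>

lemma card_edges_in_nball_le:
  assumes "finite E" "\<forall>e\<in>E. card e = 2" "girth_ge g E" "2 * n + 1 < g"
  shows "card {e \<in> E. e \<subseteq> nball E u n} \<le> card (nball E u n)"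
proof -
  obtain T where T: "T \<subseteq> E" "card T \<le> card (nball E u n)" "nball E u n \<subseteq> nball T u n"
    using nball_spanning_tree [OF assms(1)] by blast
  have fT: "finite T" using T assms finite_subset by blast
  have "e \<in> T" if e: "e \<in> E" "e \<subseteq> nball E u n" for e
  proof (rule ccontr)
    assume nT: "e \<notin> T"
    obtain x y where xy: "e = {x, y}" "x \<noteq> y" using assms e by (meson card_2_iff)
    have T2: "\<forall>e\<in>T. card e = 2" using T assms by blast
    have "x \<in> nball T u n" "y \<in> nball T u n" using e xy T by auto
    then obtain P Q where P: "P \<subseteq> T" "finite P" "card P \<le> n"
        "\<And>z. odd (inc_degree P z) \<longleftrightarrow> (z = x) \<noteq> (z = u)"
      and Q: "Q \<subseteq> T" "finite Q" "card Q \<le> n"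
        "\<And>z. odd (inc_degree Q z) \<longleftrightarrow> (z = y) \<noteq> (z = u)"
      using nball_path [OF T2, of x u n] nball_path [OF T2, of y u n] by blast
    let ?D = "sym_diff P Q"
    have fD: "finite ?D" and eD: "e \<notin> ?D" using P Q nT by auto
    \<comment> \<open>The odd degrees at \<open>u\<close> cancel in \<open>?D\<close>, which leaves
      \<open>x\<close> and \<open>y\<close> as its odd vertices; \<open>e\<close> flips
      both.\<close>
    have "even (inc_degree (insert e ?D) z)" for z
      using odd_inc_degree_sym_diff [OF P(2) Q(2), of z] P(4) [of z] Q(4) [of z] xy
      by (subst inc_degree_insert [OF fD eD]) auto
    then have "g \<le> card (insert e ?D)"
      using P Q T e fD by (intro girth_geD [OF assms(3)]) auto
    also have "\<dots> \<le> 2 * n + 1"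
      using card_sym_diff_le [OF P(2) Q(2)] P(3) Q(3) fD eD by simp
    finally show False using assms by simp
  qed
  then have "card {e \<in> E. e \<subseteq> nball E u n} \<le> card T"
    using fT by (intro card_mono) auto
  with T show ?thesis by linarith
qed

text \<open>In a minimal vertex set \<open>F\<close> spanning at least \<open>q |F|\<close> edges, every nonempty \<open>S \<subseteq> F\<close> meets at
  least \<open>q |S|\<close> of them. For a ball these edges lie in the next larger ball, which is a tree, so
  balls grow by a factor \<open>q\<close>.\<close>

lemma girth_ge_expansion:
  fixes q :: real
  assumes X: "finite X" "\<forall>e\<in>X. card e = 2" "girth_ge g X" and r: "2 * r + 1 < g"
    and dense: "q * card (\<Union>X) < card X" and q: "q \<ge> 1"
  shows "q ^ r \<le> card (\<Union>X)"
proof -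
  define I where "I S = {e \<in> X. e \<subseteq> S}" for S
  have "finite e" if "e \<in> X" for e using X(2) that by (intro card_ge_0_finite) simp
  then have fU: "finite (\<Union>X)" using X(1) by (rule finite_Union [rotated])
  \<comment> \<open>Nonemptiness is required because the empty set satisfies the inequality
    trivially and would be the minimum.\<close>
  define Q where "Q S \<longleftrightarrow> S \<subseteq> \<Union>X \<and> S \<noteq> {} \<and> q * card S \<le> card (I S)" for S
  have "I (\<Union>X) = X" by (auto simp: I_def)
  moreover have "X \<noteq> {}" using dense by auto
  then have "\<Union>X \<noteq> {}" using X(2) by (metis Union_upper card.empty ex_in_conv subset_empty zero_neq_numeral)
  ultimately have "Q (\<Union>X)" using dense by (simp add: Q_def)
  then obtain F where F: "Q F" and min: "\<And>S. Q S \<Longrightarrow> card F \<le> card S"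
    using ex_has_least_nat [of Q "\<Union>X" card] by blast
  have fF: "finite F" and F0: "F \<noteq> {}" and FU: "F \<subseteq> \<Union>X" using F fU finite_subset by (auto simp: Q_def)
  have fI: "finite (I S)" for S using X(1) by (simp add: I_def)
  have touch: "q * card S \<le> card {e \<in> I F. e \<inter> S \<noteq> {}}" if S: "S \<subseteq> F" "S \<noteq> {}" for S
  proof -
    have "real (card F) = card S + card (F - S)"
    proof -
      have "finite S" "card S \<le> card F" using S fF by (auto intro: finite_subset card_mono)
      then show ?thesis using card_Diff_subset [of S F] S by simp
    qed
    then have split: "q * card F = q * card S + q * card (F - S)" by (simp add: distrib_left)
    have eq: "I F = {e \<in> I F. e \<inter> S \<noteq> {}} \<union> I (F - S)" by (auto simp: I_def)
    have "e \<noteq> {}" if "e \<in> X" for e using X(2) that by fastforce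
    then have disj: "{e \<in> I F. e \<inter> S \<noteq> {}} \<inter> I (F - S) = {}" by (auto simp: I_def)
    have "card (I F) = card ({e \<in> I F. e \<inter> S \<noteq> {}} \<union> I (F - S))"
      using eq by (rule arg_cong)
    also have "\<dots> = card {e \<in> I F. e \<inter> S \<noteq> {}} + card (I (F - S))"
      by (intro card_Un_disjoint disj fI finite_Collect_conjI disjI1) (simp add: fI)
    finally have "card (I F) = card {e \<in> I F. e \<inter> S \<noteq> {}} + card (I (F - S))" .
    \<comment> \<open>Minimality of \<open>F\<close> applies only to nonempty sets;
      \<open>F - S = {}\<close> is settled by the absence of empty edges.\<close>
    moreover have "card (I (F - S)) \<le> q * card (F - S)"
    proof (cases "F - S = {}")
      case True
      have "I {} = {}" using X(2) by (auto simp: I_def)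
      then show ?thesis unfolding True by simp
    next
      case False
      have "card (F - S) < card F" using S fF by (intro psubset_card_mono) auto
      then have "\<not> Q (F - S)" using min [of "F - S"] by linarith
      then show ?thesis using False FU by (auto simp: Q_def)
    qed
    moreover have "q * card F \<le> card (I F)" using F by (simp add: Q_def)
    ultimately show ?thesis using split by linarith
  qed
  obtain u where u: "u \<in> F" using F0 by blast
  have sub: "nball (I F) u n \<subseteq> F" for n
    by (induction n) (use u in \<open>auto simp: I_def\<close>)
  \<comment> \<open>The bound n \<le> r keeps every ball used below half the girth, where it spans
    at most as many edges as vertices.\<close>
  have "q ^ n \<le> card (nball (I F) u n)" if "n \<le> r" for n
    using that
  proof (induction n)
    case (Suc n)
    let ?S = "nball (I F) u n"
    have inner: "e \<subseteq> nball (I F) u (Suc n)" if e: "e \<in> I F" "e \<inter> ?S \<noteq> {}" for e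
    proof
      fix y assume "y \<in> e"
      obtain x where x: "x \<in> e" "x \<in> ?S" using e by blast
      have "card e = 2" using e(1) X(2) by (simp add: I_def)
      then obtain a b where "e = {a, b}" by (auto simp: card_2_iff)
      then have "y = x \<or> e = {x, y}" using x \<open>y \<in> e\<close> by auto
      then show "y \<in> nball (I F) u (Suc n)" using x e(1) by auto
    qed
    have "q ^ Suc n \<le> q * card ?S" using Suc q by simp
    also have "\<dots> \<le> card {e \<in> I F. e \<inter> ?S \<noteq> {}}"
      using center_in_nball [of u] by (intro touch sub) blast
    also have "\<dots> \<le> card {e \<in> I F. e \<subseteq> nball (I F) u (Suc n)}"
      proof (intro of_nat_mono card_mono)
      show "finite {e \<in> I F. e \<subseteq> nball (I F) u (Suc n)}" using fI [of F] by simp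
    qed (use inner in blast)
    also have "\<dots> \<le> card (nball (I F) u (Suc n))"
    proof (intro of_nat_mono card_edges_in_nball_le)
      show "girth_ge g (I F)" by (rule girth_ge_subset [OF X(3)]) (simp add: I_def)
      show "2 * Suc n + 1 < g" using r Suc.prems by simp
    qed (use X(1,2) in \<open>auto simp: I_def\<close>)
    finally show ?case .
  qed simp
  then have "q ^ r \<le> card (nball (I F) u r)" by simp
  also have "\<dots> \<le> card (\<Union>X)"
    using sub FU fU by (intro of_nat_mono card_mono) auto
  finally show ?thesis .
qed

subsection \<open>Almost regular graphs of large girth\<close>

definition cycle_edge :: "nat \<Rightarrow> nat \<Rightarrow> nat set" where
  "cycle_edge N i = {i, Suc i mod N}"

text \<open>Indices are counted rather than edges, because for N = 2 the indices 0 and 1 give the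
  same edge.\<close>

lemma cycle_edge_incident:
  assumes "l < N" "2 \<le> N"
  shows "{j. j < N \<and> l \<in> cycle_edge N j} = {l, if l = 0 then N - 1 else l - 1}"
  using assms by (auto simp: cycle_edge_def mod_Suc split: if_splits)

lemma card_cycle_edge_incident:
  assumes "l < N" "2 \<le> N"
  shows "card {j. j < N \<and> l \<in> cycle_edge N j} = 2"
  using assms by (subst cycle_edge_incident) auto

lemma card_cycle_edge: "i < N \<Longrightarrow> 2 \<le> N \<Longrightarrow> card (cycle_edge N i) = 2"
  by (auto simp: cycle_edge_def mod_Suc)

lemma cycle_edge_subset: "i < N \<Longrightarrow> cycle_edge N i \<subseteq> {..<N}"
  by (auto simp: cycle_edge_def)

lemma inj_on_cycle_edge:
  assumes "3 \<le> N"
  shows "inj_on (cycle_edge N) {..<N}"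
  using assms by (auto simp: inj_on_def cycle_edge_def mod_Suc doubleton_eq_iff split: if_splits)

lemma inc_degree_cycle:
  assumes "3 \<le> N" "v < N"
  shows "inc_degree (cycle_edge N ` {..<N}) v = 2"
proof -
  have "{e \<in> cycle_edge N ` {..<N}. v \<in> e} = cycle_edge N ` {j. j < N \<and> v \<in> cycle_edge N j}"
    by auto
  moreover have "inj_on (cycle_edge N) {j. j < N \<and> v \<in> cycle_edge N j}"
    using inj_on_cycle_edge [OF assms(1)] by (rule inj_on_subset) auto
  ultimately show ?thesis
    using card_cycle_edge_incident [of v N] assms by (simp add: inc_degree_def card_image)
qed

text \<open>Each vertex lies on exactly two cycle edges, so even degrees force the successor of
  every edge of \<open>Y\<close> into \<open>Y\<close>. Going around once collects all N
  edges.\<close>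

lemma girth_ge_cycle:
  assumes "3 \<le> N"
  shows "girth_ge N (cycle_edge N ` {..<N})"
  unfolding girth_ge_def
proof (intro allI impI, elim conjE)
  fix Y assume Y: "Y \<subseteq> cycle_edge N ` {..<N}" "finite Y" "Y \<noteq> {}" "\<forall>v. even (inc_degree Y v)"
  have step: "cycle_edge N (Suc i mod N) \<in> Y" if i: "i < N" "cycle_edge N i \<in> Y" for i
  proof -
    let ?v = "Suc i mod N"
    have v: "?v < N" using assms by simp
    have "{e \<in> Y. ?v \<in> e} \<subseteq> cycle_edge N ` {j. j < N \<and> ?v \<in> cycle_edge N j}"
      using Y(1) by auto
    also have "{j. j < N \<and> ?v \<in> cycle_edge N j} = {?v, i}"
      using i assms by (subst cycle_edge_incident [OF v]) (auto simp: mod_Suc)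
    finally have sub: "{e \<in> Y. ?v \<in> e} \<subseteq> {cycle_edge N ?v, cycle_edge N i}" by auto
    show ?thesis
    proof (rule ccontr)
      assume "\<not> ?thesis"
      then have "{e \<in> Y. ?v \<in> e} = {cycle_edge N i}"
        using sub i(2) by (auto simp: cycle_edge_def)
      then have "inc_degree Y ?v = 1" by (simp add: inc_degree_def)
      then show False using Y(4) by (metis odd_one)
    qed
  qed
  obtain i where i: "i < N" "cycle_edge N i \<in> Y" using Y(1,3) by blast
  have all: "cycle_edge N ((i + t) mod N) \<in> Y" for t
  proof (induction t)
    case (Suc t)
    have "Suc ((i + t) mod N) mod N = (i + Suc t) mod N" by (simp add: mod_Suc_eq)
    then show ?case using step [OF _ Suc] assms by simp
  qed (use i in simp)
  have "cycle_edge N j \<in> Y" if "j < N" for j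
  proof -
    \<comment> \<open>Adding N avoids truncated subtraction when j < i.\<close>
    have "(i + (N + j - i)) mod N = j" using that i by simp
    then show ?thesis using all [of "N + j - i"] by metis
  qed
  then have "cycle_edge N ` {..<N} \<subseteq> Y" by auto
  then have "card (cycle_edge N ` {..<N}) \<le> card Y" using Y(2) by (intro card_mono)
  then show "N \<le> card Y" using card_image [OF inj_on_cycle_edge [OF assms]] by simp
qed

lemma sum_inc_degree:
  assumes "finite V" "finite E" "\<forall>e\<in>E. e \<subseteq> V \<and> card e = 2"
  shows "(\<Sum>v\<in>V. inc_degree E v) = 2 * card E"
proof -
  have "(\<Sum>v\<in>V. inc_degree E v) = (\<Sum>v\<in>V. \<Sum>e\<in>E. if v \<in> e then 1 else 0)"
    using assms(2) by (simp add: inc_degree_def sum.If_cases Int_def)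
  also have "\<dots> = (\<Sum>e\<in>E. \<Sum>v\<in>V. if v \<in> e then 1 else 0)" by (rule sum.swap)
  also have "\<dots> = (\<Sum>e\<in>E. 2)"
  proof (rule sum.cong)
    fix e assume "e \<in> E"
    then have "V \<inter> {v. v \<in> e} = e" "card e = 2" using assms(3) by auto
    then show "(\<Sum>v\<in>V. if v \<in> e then 1 else 0) = (2::nat)"
      using assms(1) by (simp add: sum.If_cases)
  qed simp
  finally show ?thesis by simp
qed

text \<open>In an edge-maximal graph of girth at least \<open>g\<close> and maximum degree at most \<open>k\<close>, joining two
  vertices of degree less than \<open>k\<close> would close a short cycle; hence these vertices all lie in one
  ball of radius \<open>g\<close>. Starting from a Hamiltonian cycle keeps all degrees at least \<open>2\<close>.\<close>

lemma ex_near_regular_girth: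
  assumes k: "2 \<le> k" and g: "1 \<le> g" and N: "3 \<le> N" "g \<le> N"
  obtains E where "\<forall>e\<in>E. e \<subseteq> {..<N} \<and> card e = 2" "girth_ge g E"
    "\<And>v. v < N \<Longrightarrow> 2 \<le> inc_degree E v \<and> inc_degree E v \<le> k"
    "k * N \<le> 2 * card E + k * Suc k ^ g"
proof -
  let ?E0 = "cycle_edge N ` {..<N}"
  define \<E> where "\<E> = {E. (\<forall>e\<in>E. e \<subseteq> {..<N} \<and> card e = 2) \<and> girth_ge g E \<and> (\<forall>v. inc_degree E v \<le> k)}"
  have fin\<E>: "finite \<E>"
    by (rule finite_subset [of _ "Pow (Pow {..<N})"]) (auto simp: \<E>_def)
  have deg0: "inc_degree ?E0 v \<le> k" for v
  proof (cases "v < N")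
    case False
    then have "{e \<in> ?E0. v \<in> e} = {}" using cycle_edge_subset by fastforce
    then show ?thesis unfolding inc_degree_def by (simp only: card.empty)
  qed (use inc_degree_cycle N k in simp)
  have g0: "girth_ge g ?E0" using girth_ge_cycle [OF N(1)] N(2) unfolding girth_ge_def by (meson le_trans)
  have "e \<subseteq> {..<N} \<and> card e = 2" if "e \<in> ?E0" for e
    using that cycle_edge_subset card_cycle_edge N(1) by fastforce
  then have "?E0 \<in> \<E>"
    using deg0 g0 by (simp add: \<E>_def)
  then obtain E where E: "E \<in> \<E>" "?E0 \<subseteq> E" and max: "\<And>F. F \<in> \<E> \<Longrightarrow> E \<subseteq> F \<Longrightarrow> E = F"
    using finite_has_maximal2 [OF fin\<E>, of ?E0] by metis
  have E2: "\<forall>e\<in>E. e \<subseteq> {..<N} \<and> card e = 2" and gE: "girth_ge g E" and dE: "\<And>v. inc_degree E v \<le> k"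
    using E(1) by (auto simp: \<E>_def)
  have "E \<subseteq> Pow {..<N}" using E2 by blast
  then have fE: "finite E" by (rule finite_subset) simp
  \<comment> \<open>The vertices that could still receive an edge.\<close>
  define D where "D = {v. v < N \<and> inc_degree E v < k}"
  have "card D \<le> Suc k ^ g"
  proof (cases "D = {}")
    case False
    then obtain u where u: "u \<in> D" by blast
    have "v \<in> nball E u g" if v: "v \<in> D" for v
    proof (cases "v = u")
      case False
      show ?thesis
      proof (cases "{u, v} \<in> E")
        case True
        then have "v \<in> nball E u 1" by simp
        then show ?thesis using nball_mono_radius [of 1 g E u] g by blast
      next
        case nE: False
        let ?F = "insert {u, v} E"
        \<comment> \<open>Both ends have spare degree, so by maximality of \<open>E\<close> only the
          girth condition can fail for \<open>?F\<close>.\<close>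
        have "inc_degree ?F z \<le> k" for z
          using u v dE [of z] by (auto simp: inc_degree_insert [OF fE nE] D_def)
        moreover have "?F \<notin> \<E>" using max [of ?F] nE by blast
        moreover have "\<forall>e\<in>?F. e \<subseteq> {..<N} \<and> card e = 2" using E2 u v False by (auto simp: D_def)
        ultimately have "\<not> girth_ge g ?F" by (auto simp: \<E>_def)
        then obtain Y where Y: "Y \<subseteq> ?F" "finite Y" "Y \<noteq> {}" "\<And>z. even (inc_degree Y z)" "card Y < g"
          unfolding girth_ge_def by (auto simp: not_le)
        \<comment> \<open>The short even set must use the new edge; deleting it leaves
          \<open>u\<close> and \<open>v\<close> as odd vertices, hence a short path between them in
          \<open>E\<close>.\<close>
        have uvY: "{u, v} \<in> Y"
        proof (rule ccontr)
          assume "{u, v} \<notin> Y"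
          then have "Y \<subseteq> E" using Y(1) by blast
          then show False using girth_geD [OF gE _ Y(2,3,4)] Y(5) by simp
        qed
        let ?Y = "Y - {{u, v}}"
        have YE: "?Y \<subseteq> E" and fY: "finite ?Y" using Y by auto
        have "inc_degree Y z = inc_degree ?Y z + (if z \<in> {u, v} then 1 else 0)" for z
          using inc_degree_insert [OF fY, of "{u, v}" z] uvY by (simp add: insert_absorb)
        then have odd: "odd (inc_degree ?Y z) \<longleftrightarrow> z = u \<or> z = v" for z
          using Y(4) [of z] by (auto split: if_splits)
        have Y2: "\<forall>e\<in>?Y. card e = 2" using YE E2 by blast
        have "v \<in> nball ?Y u (card ?Y)"
          using odd_ends_in_nball [OF fY Y2 _ odd] False by simp
        then have "v \<in> nball E u (card ?Y)" using nball_mono_edges [OF YE, of u "card ?Y"] by blast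
        moreover have "card ?Y \<le> g" using card_Diff1_le [of Y "{u, v}"] Y(5) by linarith
        ultimately show ?thesis
          using nball_mono_radius [of "card ?Y" g E u] by blast
      qed
    qed (simp add: center_in_nball)
    then have "card D \<le> card (nball E u g)"
      using finite_nball [OF fE] by (intro card_mono) auto
    also have "\<dots> \<le> Suc k ^ g" using card_nball_le [OF fE dE] .
    finally show ?thesis .
  qed simp
  then have kD: "k * card D \<le> k * Suc k ^ g" by simp
  have D: "D \<subseteq> {..<N}" by (auto simp: D_def)
  \<comment> \<open>Vertices outside \<open>D\<close> have degree exactly k, so the degree sum falls
    short of k N by at most k times the size of \<open>D\<close>.\<close>
  have "k * N = k * card D + k * card ({..<N} - D)"
    using D card_Diff_subset [of D "{..<N}"] card_mono [OF _ D] finite_subset [OF D]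
    by (simp add: add_mult_distrib2 [symmetric])
  also have "k * card ({..<N} - D) = (\<Sum>v\<in>{..<N} - D. k)" by simp
  also have "\<dots> \<le> (\<Sum>v\<in>{..<N} - D. inc_degree E v)"
    by (intro sum_mono) (auto simp: D_def)
  also have "\<dots> \<le> (\<Sum>v\<in>{..<N}. inc_degree E v)" by (intro sum_mono2) auto
  also have "\<dots> = 2 * card E" using fE E2 by (intro sum_inc_degree) auto
  finally have "k * N \<le> 2 * card E + k * Suc k ^ g" using kD by linarith
  moreover have "2 \<le> inc_degree E v" if "v < N" for v
  proof -
    have "inc_degree ?E0 v \<le> inc_degree E v"
      unfolding inc_degree_def using E(2) fE by (intro card_mono) auto
    then show ?thesis using inc_degree_cycle [OF N(1) that] by simp
  qed
  ultimately show thesis using that E2 gE dE by blast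
qed

subsection \<open>Incidence graphs\<close>

text \<open>The conclusion of the theorem with the ratio as a parameter, shared by the two
  constructions.\<close>

definition local_search_gap :: "nat \<Rightarrow> real \<Rightarrow> real \<Rightarrow> nat \<Rightarrow> real \<Rightarrow> bool" where
  "local_search_gap d \<alpha> C N\<^sub>0 \<rho> \<longleftrightarrow>
    (\<exists>(V :: nat set) (E :: nat set set) (w :: nat \<Rightarrow> real) (A :: nat set).
           fin_simple_graph V E \<and> card V \<ge> N\<^sub>0 \<and>
           (\<forall>v\<in>V. w v > 0) \<and>
           independent_set V E A \<and>
           ((\<forall>v\<in>V. 2 \<le> vertex_degree V E v \<and> vertex_degree V E v \<le> d - 1) \<and> claw_free V E d) \<and>
           (\<forall>X. independent_set V E X \<and> real (card X) \<le> C * log 2 (real (card V)) \<longrightarrow>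
                weight_pow w \<alpha> X \<le> weight_pow w \<alpha> (nbhd E X A)) \<and>
           (\<forall>S. max_weight_independent_set V E w S \<longrightarrow> weight w S \<ge> \<rho> * weight w A))"

text \<open>Reduces the theorem to a family of sets \<open>h j\<close>: \<open>A\<close> is the
  ground set, and vertex \<open>n + j\<close> of \<open>B\<close> is joined to the elements of
  \<open>h j\<close>. In an independent \<open>X\<close>, the part in \<open>A\<close> avoids the
  neighbours of the part in \<open>B\<close> and counts equally on both sides, so \<open>loc\<close>
  need only treat subsets of \<open>B\<close>. Since \<open>B\<close> is independent,
  \<open>ratio\<close> bounds the optimum from below.\<close>

lemma local_search_gap_incidence_graph:
  fixes h :: "nat \<Rightarrow> nat set" and n m d N\<^sub>0 :: nat and a :: "nat \<Rightarrow> real" and b \<alpha> C \<rho> :: real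
  assumes d: "1 \<le> d"
    and h: "\<And>j. j < m \<Longrightarrow> h j \<subseteq> {..<n} \<and> 2 \<le> card (h j) \<and> card (h j) \<le> d - 1"
    and deg: "\<And>i. i < n \<Longrightarrow> 2 \<le> card {j. j < m \<and> i \<in> h j} \<and> card {j. j < m \<and> i \<in> h j} \<le> d - 1"
    and pos: "\<And>i. i < n \<Longrightarrow> a i > 0" "b > 0"
    and loc: "\<And>Y. Y \<subseteq> {..<m} \<Longrightarrow> real (card Y) \<le> C * log 2 (real (n + m)) \<Longrightarrow>
                real (card Y) * b powr \<alpha> \<le> (\<Sum>i\<in>\<Union>(h ` Y). a i powr \<alpha>)"
    and ratio: "\<rho> * (\<Sum>i<n. a i) \<le> real m * b"
    and large: "N\<^sub>0 \<le> n + m"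
  shows "local_search_gap d \<alpha> C N\<^sub>0 \<rho>"
proof -
  define V where "V = {..<n + m}"
  define E where "E = {{i, n + j} | i j. j < m \<and> i \<in> h j}"
  define w where "w v = (if v < n then a v else b)" for v
  let ?A = "{..<n}" and ?B = "{n..<n + m}"
  have hn: "i < n" if "j < m" "i \<in> h j" for i j using h that by blast
  have edge_AB: "{i, n + j} \<in> E \<longleftrightarrow> j < m \<and> i \<in> h j" if "i < n" for i j
    using that hn by (fastforce simp: E_def doubleton_eq_iff)
  have A_indep: "{i, i'} \<notin> E" if "i < n" "i' < n" for i i'
    using that by (auto simp: E_def doubleton_eq_iff)
  have B_indep: "{i, i'} \<notin> E" if "n \<le> i" "n \<le> i'" for i i'
    using that hn by (fastforce simp: E_def doubleton_eq_iff)
  have graph: "fin_simple_graph V E"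
    unfolding fin_simple_graph_def
  proof (intro conjI ballI)
    fix e assume "e \<in> E"
    then obtain i j where e: "e = {i, n + j}" "j < m" "i \<in> h j" by (auto simp: E_def)
    then show "e \<subseteq> V" "card e = 2" using hn [OF e(2,3)] by (auto simp: V_def)
  qed (simp add: V_def)
  have degrees: "2 \<le> vertex_degree V E v \<and> vertex_degree V E v \<le> d - 1" if v: "v \<in> V" for v
  proof (cases "v < n")
    case True
    have "{u \<in> V. {v, u} \<in> E} = (+) n ` {j. j < m \<and> v \<in> h j}"
    proof (intro equalityI subsetI)
      fix u assume "u \<in> {u \<in> V. {v, u} \<in> E}"
      then have u: "{v, u} \<in> E" by simp
      then have "n \<le> u" using A_indep [OF True, of u] by force
      then obtain j where j: "u = n + j" using le_Suc_ex by blast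
      then have "j < m \<and> v \<in> h j" using edge_AB [OF True, of j] u by simp
      then show "u \<in> (+) n ` {j. j < m \<and> v \<in> h j}" using j by blast
    next
      fix u assume "u \<in> (+) n ` {j. j < m \<and> v \<in> h j}"
      then obtain j where "u = n + j" "j < m" "v \<in> h j" by blast
      then show "u \<in> {u \<in> V. {v, u} \<in> E}" using edge_AB [OF True, of j] by (simp add: V_def)
    qed
    then show ?thesis using deg [OF True] by (simp add: vertex_degree_def card_image)
  next
    case False
    define j where "j = v - n"
    have j: "v = n + j" "j < m" using v False by (auto simp: V_def j_def)
    have "{u \<in> V. {v, u} \<in> E} = h j"
    proof (intro equalityI subsetI)
      fix u assume "u \<in> {u \<in> V. {v, u} \<in> E}"
      then have u: "{u, n + j} \<in> E" by (simp add: j insert_commute)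
      then have "u < n" using B_indep [of u "n + j"] by force
      then show "u \<in> h j" using edge_AB u by blast
    next
      fix u assume u: "u \<in> h j"
      then have "u < n" using hn j by blast
      then show "u \<in> {u \<in> V. {v, u} \<in> E}"
        using edge_AB [of u j] u j by (simp add: V_def insert_commute)
    qed
    then show ?thesis using h [OF j(2)] by (simp add: vertex_degree_def)
  qed
  have claw: "claw_free V E d"
    unfolding claw_free_def
  proof (intro notI, elim exE)
    fix c T assume "induced_claw V E d c T"
    then have T: "c \<in> V" "card T = d" "T \<subseteq> {u \<in> V. {c, u} \<in> E}"
      by (auto simp: induced_claw_def independent_set_def)
    then have "d \<le> vertex_degree V E c"
      unfolding vertex_degree_def using card_mono [of "{u \<in> V. {c, u} \<in> E}" T] by (simp add: V_def)
    then show False using degrees [OF T(1)] d by arith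
  qed
  have local: "weight_pow w \<alpha> X \<le> weight_pow w \<alpha> (nbhd E X ?A)"
    if X: "independent_set V E X" "real (card X) \<le> C * log 2 (real (card V))" for X
  proof -
    define Y where "Y = {j. j < m \<and> n + j \<in> X}"
    have XV: "X \<subseteq> V" and ind: "\<And>u v. u \<in> X \<Longrightarrow> v \<in> X \<Longrightarrow> {u, v} \<notin> E"
      using X(1) by (auto simp: independent_set_def)
    have fX: "finite X" using XV by (rule finite_subset) (simp add: V_def)
    have fY: "finite Y" by (simp add: Y_def)
    have Xeq: "X = (X \<inter> ?A) \<union> (+) n ` Y"
    proof (intro equalityI subsetI)
      fix x assume "x \<in> X"
      show "x \<in> (X \<inter> ?A) \<union> (+) n ` Y"
      proof (cases "x < n")
        case False
        then obtain j where "x = n + j" using le_Suc_ex not_less by blast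
        moreover have "x < n + m" using XV \<open>x \<in> X\<close> by (auto simp: V_def)
        ultimately have "x = n + j" "j \<in> Y" using \<open>x \<in> X\<close> by (auto simp: Y_def)
        then show ?thesis by blast
      qed (use \<open>x \<in> X\<close> in simp)
    qed (auto simp: Y_def)
    have "card Y = card ((+) n ` Y)" by (simp add: card_image)
    also have "\<dots> \<le> card X" using fX by (intro card_mono) (auto simp: Y_def)
    finally have "real (card Y) \<le> C * log 2 (real (n + m))" using X(2) by (simp add: V_def)
    then have Yw: "real (card Y) * b powr \<alpha> \<le> (\<Sum>i\<in>\<Union>(h ` Y). a i powr \<alpha>)"
      by (intro loc) (auto simp: Y_def)
    have hY: "\<Union>(h ` Y) \<subseteq> ?A" using h by (auto simp: Y_def)
    \<comment> \<open>A common element would be adjacent to some \<open>n + j\<close> in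
      \<open>X\<close>.\<close>
    have disj: "(X \<inter> ?A) \<inter> \<Union>(h ` Y) = {}"
    proof (rule ccontr)
      assume "(X \<inter> ?A) \<inter> \<Union>(h ` Y) \<noteq> {}"
      then obtain i j where "i \<in> X" "i < n" "j \<in> Y" "i \<in> h j" by blast
      then show False using edge_AB [of i j] ind [of i "n + j"] by (simp add: Y_def)
    qed
    have "weight_pow w \<alpha> X = (\<Sum>i\<in>X \<inter> ?A. w i powr \<alpha>) + (\<Sum>i\<in>(+) n ` Y. w i powr \<alpha>)"
      unfolding weight_pow_def using fX fY
      by (subst Xeq, intro sum.union_disjoint) auto
    also have "(\<Sum>i\<in>(+) n ` Y. w i powr \<alpha>) = real (card Y) * b powr \<alpha>"
      by (simp add: sum.reindex w_def)
    also have "\<dots> \<le> (\<Sum>i\<in>\<Union>(h ` Y). w i powr \<alpha>)"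
    proof -
      have "(\<Sum>i\<in>\<Union>(h ` Y). w i powr \<alpha>) = (\<Sum>i\<in>\<Union>(h ` Y). a i powr \<alpha>)"
        using hY by (intro sum.cong) (auto simp: w_def)
      with Yw show ?thesis by simp
    qed
    also have "(\<Sum>i\<in>X \<inter> ?A. w i powr \<alpha>) + (\<Sum>i\<in>\<Union>(h ` Y). w i powr \<alpha>)
        = (\<Sum>i\<in>(X \<inter> ?A) \<union> \<Union>(h ` Y). w i powr \<alpha>)"
      using disj finite_subset [OF hY] by (intro sum.union_disjoint [symmetric]) auto
    also have "\<dots> \<le> weight_pow w \<alpha> (nbhd E X ?A)"
      unfolding weight_pow_def
    proof (rule sum_mono2)
      \<comment> \<open>Elements of \<open>X\<close> in \<open>A\<close> enter through the clause
        \<open>u = x\<close> of \<open>nbhd\<close>.\<close>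
      show "(X \<inter> ?A) \<union> \<Union>(h ` Y) \<subseteq> nbhd E X ?A"
      proof
        fix i assume i: "i \<in> (X \<inter> ?A) \<union> \<Union>(h ` Y)"
        then have "i < n" using hY by auto
        show "i \<in> nbhd E X ?A"
        proof (cases "i \<in> X")
          case False
          then obtain j where "j \<in> Y" "i \<in> h j" using i by blast
          then have "n + j \<in> X" "{n + j, i} \<in> E"
            using edge_AB [OF \<open>i < n\<close>, of j] by (auto simp: Y_def insert_commute)
          then show ?thesis using \<open>i < n\<close> by (auto simp: nbhd_def)
        qed (use \<open>i < n\<close> in \<open>auto simp: nbhd_def\<close>)
      qed
    qed (auto simp: nbhd_def)
    finally show ?thesis by simp
  qed
  have B: "independent_set V E ?B"
    using B_indep by (auto simp: independent_set_def V_def)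
  have "weight w ?B = real m * b" by (simp add: weight_def w_def)
  moreover have "weight w ?A = (\<Sum>i<n. a i)" by (simp add: weight_def w_def)
  ultimately have "\<rho> * weight w ?A \<le> weight w S" if "max_weight_independent_set V E w S" for S
    using that B ratio unfolding max_weight_independent_set_def by fastforce
  moreover have "independent_set V E ?A"
    using A_indep by (auto simp: independent_set_def V_def)
  moreover have "\<forall>v\<in>V. w v > 0" using pos by (simp add: w_def)
  moreover have "N\<^sub>0 \<le> card V" using large by (simp add: V_def)
  ultimately show ?thesis
    unfolding local_search_gap_def
    using graph degrees claw local by (intro exI [of _ V] exI [of _ E] exI [of _ w] exI [of _ ?A]) blast
qed

section \<open>The two constructions, for \<alpha> \<le> 0 and for \<alpha> > 0\<close>

lemma ex_pow_gt_linear: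
  fixes q a b :: real
  assumes "1 < q"
  obtains r where "n \<le> r" "a * real r + b < q ^ r"
proof -
  have "eventually (\<lambda>r::nat. a * real r + b < q ^ r) sequentially"
    using assms by real_asymp
  then have "eventually (\<lambda>r. n \<le> r \<and> a * real r + b < q ^ r) sequentially"
    using eventually_ge_at_top [of n] by eventually_elim simp
  then show thesis using that eventually_happens [of _ sequentially] by auto
qed

text \<open>For \<open>\<alpha> \<le> 0\<close> light vertices of \<open>A\<close> cost little in \<open>w\<close> but count at least as much as a vertex
  of weight \<open>1\<close> in \<open>w\<^sup>\<alpha>\<close>: \<open>B\<close> is matched into light vertices arranged in a cycle,
  while each heavy vertex of \<open>A\<close> has \<open>d - 1\<close> private neighbours. For \<open>d = 3\<close> the cycle alone suffices.\<close>

lemma local_search_gap_nonpos: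
  fixes d :: nat and \<alpha> \<epsilon> C :: real and N\<^sub>0 :: nat
  assumes d: "d \<ge> 3" and \<epsilon>: "0 < \<epsilon>" "\<epsilon> < 1" and \<alpha>: "\<alpha> \<le> 0"
  shows "local_search_gap d \<alpha> C N\<^sub>0 ((real d - 1 - \<epsilon>) / 2)"
proof -
  define k t where "k = d - 1" and "t = N\<^sub>0 + 2"
  \<comment> \<open>There are \<open>m\<close> light vertices of weight 1/k and \<open>s\<close>
    heavy ones of weight 1, so \<open>A\<close> weighs at most 2t, while the \<open>m\<close>
    vertices of \<open>B\<close> weigh kt. For d = 3 the two cycle neighbours already exhaust the
    degree bound on \<open>B\<close>, hence s = 0.\<close>
  define m s where "m = k * t" and "s = (if d = 3 then 0 else t)"
  define h where "h j = cycle_edge m j \<union> (if d = 3 then {} else {m + j div k})" for j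
  define a :: "nat \<Rightarrow> real" where "a i = (if i < m then 1 / real k else 1)" for i
  have k: "2 \<le> k" "real k = real d - 1" using d by (auto simp: k_def)
  have "1 * t \<le> m" unfolding m_def using k(1) by (intro mult_le_mono) auto
  then have m: "N\<^sub>0 \<le> m" "2 \<le> m" by (auto simp: t_def)
  have div_less: "j div k < t" if "j < m" for j
    using that k(1) by (simp add: m_def less_mult_imp_div_less mult.commute)
  show ?thesis
  proof (rule local_search_gap_incidence_graph [where h = h and n = "m + s" and m = m and a = a and b = 1])
    fix j assume j: "j < m"
    have c: "cycle_edge m j \<subseteq> {..<m}" "card (cycle_edge m j) = 2"
      using j m cycle_edge_subset card_cycle_edge by auto
    have "h j \<subseteq> {..<m + s}" using c(1) div_less [OF j] by (auto simp: h_def s_def)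
    moreover have "2 \<le> card (h j) \<and> card (h j) \<le> d - 1"
    proof (cases "d = 3")
      case False
      have "m + j div k \<notin> cycle_edge m j" using c(1) by auto
      moreover have "finite (cycle_edge m j)" by (simp add: cycle_edge_def)
      ultimately have "card (h j) = 3" using False c(2) by (simp add: h_def)
      then show ?thesis using False d by simp
    qed (simp add: h_def c)
    ultimately show "h j \<subseteq> {..<m + s} \<and> 2 \<le> card (h j) \<and> card (h j) \<le> d - 1" by simp
  next
    fix i assume i: "i < m + s"
    show "2 \<le> card {j. j < m \<and> i \<in> h j} \<and> card {j. j < m \<and> i \<in> h j} \<le> d - 1"
    proof (cases "i < m")
      case True
      then have "{j. j < m \<and> i \<in> h j} = {j. j < m \<and> i \<in> cycle_edge m j}" by (auto simp: h_def)
      then show ?thesis using card_cycle_edge_incident [OF True m(2)] d by simp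
    next
      case False
      define l where "l = i - m"
      have l: "i = m + l" "l < t" and d3: "d \<noteq> 3"
        using i False by (auto simp: l_def s_def split: if_splits)
      have "i \<notin> cycle_edge m j" if "j < m" for j using cycle_edge_subset [OF that] False by auto
      then have "{j. j < m \<and> i \<in> h j} = {j. j < m \<and> j div k = l}"
        using l d3 by (auto simp: h_def)
      \<comment> \<open>The neighbours of a heavy vertex form a block of k consecutive
        indices.\<close>
      also have "\<dots> = {k * l..<k * l + k}"
      proof (intro equalityI subsetI)
        fix j assume "j \<in> {j. j < m \<and> j div k = l}"
        then have "l = j div k" by simp
        moreover have "j = k * (j div k) + j mod k" by simp
        moreover have "j mod k < k" using k(1) by simp
        ultimately show "j \<in> {k * l..<k * l + k}" by (metis add_less_cancel_left atLeastLessThan_iff le_add1)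
      next
        fix j assume j: "j \<in> {k * l..<k * l + k}"
        then have "j div k = l" by (intro div_nat_eqI) (auto simp: mult.commute)
        moreover have "k * l + k \<le> m"
          using mult_le_mono2 [of "Suc l" t k] l(2) by (simp add: m_def)
        ultimately show "j \<in> {j. j < m \<and> j div k = l}" using j by simp
      qed
      finally show ?thesis using k(1) by (simp add: k_def)
    qed
  next
    show "0 < a i" if "i < m + s" for i using k(1) by (simp add: a_def)
  next
    fix Y assume Y: "Y \<subseteq> {..<m}"
    have fin: "finite (\<Union>(h ` Y))"
      using finite_subset [OF Y] by (auto simp: h_def cycle_edge_def)
    have "(1 / real k) powr 0 \<le> (1 / real k) powr \<alpha>"
      using \<alpha> k(1) by (intro powr_mono') auto
    then have "1 \<le> (1 / real k) powr \<alpha>" using k(1) by simp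
    then have "real (card Y) * 1 powr \<alpha> \<le> real (card Y) * (1 / real k) powr \<alpha>"
      by (intro mult_left_mono) auto
    also have "\<dots> = (\<Sum>i\<in>Y. a i powr \<alpha>)" using Y by (auto simp: a_def subset_eq)
    \<comment> \<open>The matching sends \<open>j\<close> to light vertex \<open>j\<close>, an
      element of \<open>cycle_edge m j\<close>; thus \<open>Y\<close> lies in the union.\<close>
    also have "\<dots> \<le> (\<Sum>i\<in>\<Union>(h ` Y). a i powr \<alpha>)"
      using fin by (intro sum_mono2) (auto simp: h_def cycle_edge_def)
    finally show "real (card Y) * 1 powr \<alpha> \<le> (\<Sum>i\<in>\<Union>(h ` Y). a i powr \<alpha>)" .
  next
    have "(\<Sum>i<m + s. a i) = (\<Sum>i<m. a i) + (\<Sum>i=m..<m + s. a i)"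
      using sum.atLeastLessThan_concat [of 0 m "m + s" a] by (simp add: lessThan_atLeast0)
    also have "(\<Sum>i<m. a i) = real m / real k" by (simp add: a_def)
    also have "\<dots> = t" using k(1) by (simp add: m_def)
    also have "(\<Sum>i=m..<m + s. a i) = s" by (simp add: a_def)
    finally have "(\<Sum>i<m + s. a i) \<le> 2 * real t" by (simp add: s_def)
    then have "(real d - 1 - \<epsilon>) / 2 * (\<Sum>i<m + s. a i) \<le> (real d - 1 - \<epsilon>) / 2 * (2 * real t)"
      using d \<epsilon> by (intro mult_left_mono) auto
    also have "\<dots> = (real d - 1 - \<epsilon>) * t" by simp
    also have "\<dots> \<le> real k * t" using k(2) \<epsilon> by (intro mult_right_mono) auto
    finally show "(real d - 1 - \<epsilon>) / 2 * (\<Sum>i<m + s. a i) \<le> real m * 1" by (simp add: m_def)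
  qed (use d m in auto)
qed

text \<open>Order of choice: \<open>\<beta>\<close> and \<open>M\<close> each cost about
  \<epsilon>/2 in the ratio and do not depend on \<open>r\<close>. With \<open>g\<close> linear in
  \<open>r\<close> and \<open>N = M * Suc k ^ g\<close>, the allowed size of \<open>X\<close> is
  linear in \<open>r\<close>, while expansion demands \<open>q ^ r\<close> vertices.\<close>

lemma local_search_gap_pos:
  fixes d :: nat and \<alpha> \<epsilon> C :: real and N\<^sub>0 :: nat
  assumes d: "d \<ge> 3" and \<epsilon>: "0 < \<epsilon>" "\<epsilon> < 1" and C: "C > 0" and \<alpha>: "0 < \<alpha>"
  shows "local_search_gap d \<alpha> C N\<^sub>0 ((real d - 1 - \<epsilon>) / 2)"
proof -
  define k where "k = d - 1"
  have k: "2 \<le> k" "real k = real d - 1" using d by (auto simp: k_def)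
  define \<beta> where "\<beta> = 1 - \<epsilon> / (2 * real k)"
  have "\<epsilon> / (2 * real k) < 1" "0 < \<epsilon> / (2 * real k)" using k(1) \<epsilon> by (auto simp: field_simps)
  then have \<beta>: "0 < \<beta>" "\<beta> < 1" by (auto simp: \<beta>_def)
  define q where "q = 1 / \<beta> powr \<alpha>"
  have \<beta>\<alpha>: "0 < \<beta> powr \<alpha>" "\<beta> powr \<alpha> < 1" using \<beta> \<alpha> powr_less_mono2 [of \<alpha> \<beta> 1] by auto
  then have q: "1 < q" by (simp add: q_def)
  \<comment> \<open>The factor \<open>M\<close> makes the degree deficit
    \<open>k * Suc k ^ g\<close> at most \<epsilon> N / 2.\<close>
  obtain M0 :: nat where M0: "2 * real k / \<epsilon> \<le> real M0" using real_arch_simple by blast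
  define M where "M = max M0 3"
  have M: "2 * real k / \<epsilon> \<le> real M" "3 \<le> M" using M0 by (auto simp: M_def)
  define c where "c = log 2 (real (Suc k))"
  \<comment> \<open>The linear term is C (log M + (g + 1) c) for g = 2r + 2, an upper bound for C
    log(N + m).\<close>
  obtain r where r: "N\<^sub>0 \<le> r" "(2 * C * c) * real r + C * (log 2 M + 3 * c) < q ^ r"
    using ex_pow_gt_linear [OF q] by blast
  define g where "g = 2 * r + 2"
  define N where "N = M * Suc k ^ g"
  have "g < 2 ^ g" by (rule less_exp)
  also have "\<dots> \<le> Suc k ^ g" using k(1) by (intro power_mono) auto
  finally have gk: "g < Suc k ^ g" .
  then have "3 * Suc k ^ g \<le> N" unfolding N_def using M(2) by (intro mult_le_mono) auto
  then have N: "3 \<le> N" "g \<le> N" using gk by auto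
  obtain E where E: "\<forall>e\<in>E. e \<subseteq> {..<N} \<and> card e = 2" "girth_ge g E"
    and degE: "\<And>v. v < N \<Longrightarrow> 2 \<le> inc_degree E v \<and> inc_degree E v \<le> k"
    and cardE: "k * N \<le> 2 * card E + k * Suc k ^ g"
    using ex_near_regular_girth [of k g N] k(1) N by (auto simp: g_def)
  have "E \<subseteq> Pow {..<N}" using E(1) by blast
  then have fE: "finite E" by (rule finite_subset) simp
  define m where "m = card E"
  obtain h where "bij_betw h {0..<card E} E" using ex_bij_betw_nat_finite [OF fE] by blast
  then have h: "inj_on h {..<m}" "h ` {..<m} = E" by (auto simp: m_def bij_betw_def lessThan_atLeast0)
  have "2 * m = (\<Sum>v<N. inc_degree E v)" using sum_inc_degree [of "{..<N}" E] fE E(1) by (simp add: m_def)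
  also have "\<dots> \<le> (\<Sum>v<N. k)" using degE by (intro sum_mono) simp
  finally have "N + m \<le> Suc k * N" by (simp add: mult.commute)
  also have "\<dots> = M * Suc k ^ (g + 1)" by (simp add: N_def algebra_simps)
  finally have Nm: "real (N + m) \<le> real M * real (Suc k) ^ (g + 1)"
    by (metis of_nat_le_iff of_nat_mult of_nat_power)
  have "log 2 (real (N + m)) \<le> log 2 (real M * real (Suc k) ^ (g + 1))"
    using Nm N(1) by (subst log_le_cancel_iff) auto
  also have "\<dots> = log 2 M + real (g + 1) * c"
  proof -
    have "log 2 (real (Suc k) ^ (g + 1)) = real (g + 1) * c"
      unfolding c_def by (intro log_nat_power) simp
    moreover have "real M \<noteq> 0" "real (Suc k) ^ (g + 1) \<noteq> 0" using M(2) by auto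
    ultimately show ?thesis by (simp only: log_mult if_True if_False simp_thms)
  qed
  finally have "C * log 2 (real (N + m)) \<le> C * (log 2 M + real (g + 1) * c)"
    using C by (intro mult_left_mono) auto
  also have "\<dots> = (2 * C * c) * real r + C * (log 2 M + 3 * c)"
    by (simp add: g_def algebra_simps)
  finally have small: "C * log 2 (real (N + m)) < q ^ r" using r(2) by linarith
  show ?thesis
  proof (rule local_search_gap_incidence_graph [where h = h and n = N and m = m and a = "\<lambda>_. 1" and b = \<beta>])
    fix j assume "j < m"
    then have "h j \<in> E" using h(2) by blast
    then show "h j \<subseteq> {..<N} \<and> 2 \<le> card (h j) \<and> card (h j) \<le> d - 1"
      using E(1) k(1) by (auto simp: k_def)
  next
    fix i assume i: "i < N"
    have "{e \<in> E. i \<in> e} = h ` {j. j < m \<and> i \<in> h j}" using h(2) by auto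
    moreover have "inj_on h {j. j < m \<and> i \<in> h j}" using h(1) by (rule inj_on_subset) auto
    ultimately have "inc_degree E i = card {j. j < m \<and> i \<in> h j}" by (simp add: inc_degree_def card_image)
    then show "2 \<le> card {j. j < m \<and> i \<in> h j} \<and> card {j. j < m \<and> i \<in> h j} \<le> d - 1"
      using degE [OF i] by (simp add: k_def)
  next
    fix Y assume Y: "Y \<subseteq> {..<m}" "real (card Y) \<le> C * log 2 (real (N + m))"
    let ?X = "h ` Y"
    have XE: "?X \<subseteq> E" using Y(1) h(2) by blast
    have cX: "card ?X = card Y" using h(1) Y(1) by (meson card_image inj_on_subset)
    \<comment> \<open>Otherwise \<open>?X\<close> has more than q edges per covered vertex and must
      cover at least \<open>q ^ r\<close> vertices; but it covers at most \<open>card Y\<close> of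
      them, which is below \<open>q ^ r\<close>.\<close>
    have "real (card Y) * \<beta> powr \<alpha> \<le> card (\<Union>?X)"
    proof (rule ccontr)
      assume "\<not> ?thesis"
      then have neg: "card (\<Union>?X) < real (card Y) * \<beta> powr \<alpha>" by simp
      have "q * card (\<Union>?X) < q * (real (card Y) * \<beta> powr \<alpha>)"
        using neg q by (intro mult_strict_left_mono) auto
      also have "\<dots> = card ?X" using \<beta>\<alpha>(1) cX by (simp add: q_def)
      finally have dense: "q * card (\<Union>?X) < card ?X" .
      have "q ^ r \<le> card (\<Union>?X)"
      proof (rule girth_ge_expansion [OF _ _ _ _ dense])
        show "finite ?X" using XE fE by (rule finite_subset)
        show "\<forall>e\<in>?X. card e = 2" using XE E(1) by blast
        show "girth_ge g ?X" using E(2) XE by (rule girth_ge_subset)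
        show "2 * r + 1 < g" by (simp add: g_def)
        show "1 \<le> q" using q by simp
      qed
      also have "real (card (\<Union>?X)) \<le> real (card Y) * 1"
        using neg mult_left_mono [of "\<beta> powr \<alpha>" 1 "real (card Y)"] \<beta>\<alpha>(2) by linarith
      finally show False using Y(2) small by simp
    qed
    then show "real (card Y) * \<beta> powr \<alpha> \<le> (\<Sum>i\<in>\<Union>?X. 1 powr \<alpha>)" by simp
  next
    have "\<epsilon> * real M \<ge> 2 * real k" using M(1) \<epsilon>(1) by (simp add: field_simps)
    then have "\<epsilon> * real M * real (Suc k ^ g) \<ge> 2 * real k * real (Suc k ^ g)"
      by (intro mult_right_mono) auto
    then have "\<epsilon> * real N \<ge> 2 * (real k * real (Suc k ^ g))" by (simp add: N_def mult.assoc)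
    moreover have "real k * real N \<le> 2 * real m + real k * real (Suc k ^ g)"
      using cardE unfolding m_def
      by (metis (mono_tags) of_nat_add of_nat_le_iff of_nat_mult of_nat_numeral)
    ultimately have "(real k - \<epsilon> / 2) * real N \<le> 2 * real m" by (simp add: algebra_simps)
    then have "(real k - \<epsilon> / 2) * real N * \<beta> \<le> 2 * real m * \<beta>"
      using \<beta>(1) by (intro mult_right_mono) auto
    moreover have "real k - \<epsilon> \<le> (real k - \<epsilon> / 2) * \<beta>"
    proof -
      \<comment> \<open>The choice of \<open>\<beta>\<close> makes its loss cancel to first order,
        leaving a nonnegative square.\<close>
      have "(real k - \<epsilon> / 2) * \<beta> = real k - \<epsilon> + \<epsilon>\<^sup>2 / (4 * real k)"
        using k(1) by (simp add: \<beta>_def field_simps power2_eq_square)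
      then show ?thesis by simp
    qed
    then have "(real k - \<epsilon>) * real N \<le> (real k - \<epsilon> / 2) * \<beta> * real N"
      by (intro mult_right_mono) auto
    ultimately have "(real k - \<epsilon>) * real N \<le> 2 * (real m * \<beta>)" by (simp add: mult_ac)
    then show "(real d - 1 - \<epsilon>) / 2 * (\<Sum>i<N. 1) \<le> real m * \<beta>" using k(2) by simp
  next
    show "N\<^sub>0 \<le> N + m" using r(1) N(2) by (simp add: g_def)
  qed (use d \<beta> in auto)
qed

theorem theorem42:
  fixes d :: nat and \<alpha> \<epsilon> C :: real and N\<^sub>0 :: nat
  assumes "d \<ge> 3" and "0 < \<epsilon>" and "\<epsilon> < 1" and "C > 0"
  shows "\<exists>(V :: nat set) (E :: nat set set) (w :: nat \<Rightarrow> real) (A :: nat set).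
           fin_simple_graph V E \<and> card V \<ge> N\<^sub>0 \<and>
           (\<forall>v\<in>V. w v > 0) \<and>
           independent_set V E A \<and>
           ((\<forall>v\<in>V. 2 \<le> vertex_degree V E v \<and> vertex_degree V E v \<le> d - 1) \<and> claw_free V E d) \<and>
           (\<forall>X. independent_set V E X \<and> real (card X) \<le> C * log 2 (real (card V)) \<longrightarrow>
                weight_pow w \<alpha> X \<le> weight_pow w \<alpha> (nbhd E X A)) \<and>
           (\<forall>S. max_weight_independent_set V E w S \<longrightarrow>
                weight w S \<ge> (real d - 1 - \<epsilon>) / 2 * weight w A)"
proof (cases "\<alpha> \<le> 0")
  case True
  show ?thesis
    using local_search_gap_nonpos [OF assms(1-3) True] unfolding local_search_gap_def .
next
  case False
  then have "0 < \<alpha>" by simp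
  show ?thesis
    using local_search_gap_pos [OF assms \<open>0 < \<alpha>\<close>] unfolding local_search_gap_def .
qed

end
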